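(* Let $n \ge 1$, let $V \subset \mathbb{R}^{2n}$ be a structure cone for $\mathbb{I}_n$ with MSTD vector $d$ such that $d \cdot v > 0$ for some $v \in V$, and let $S$ be a full-dimensional rational simplicial cone belonging to a partition of the polyhedral cone $V \cap \{v \in \mathbb{R}^{2n} : d \cdot v \ge 0\}$ into simplicial cones. Let $v_1, \dots, v_{2n} \in \mathbb{Z}^{2n}$ be the primitive integer vectors generating $S$, let $A$ be the $2n \times 2n$ matrix with columns $v_1, \dots, v_{2n}$, and let $D = |\det(A)|$. Let $v_{i_1}, \dots, v_{i_r}$ be those $v_i$ such that $v_i \cdot d > 0$. Let $p \in \mathbb{Z}^{2n}$ be any particular solution of $$A p \equiv (3D, D, 3D, D, \dots, 3D, D)^T \pmod{4D}.$$ Then a point $m \in \mathbb{R}^{2n}$ is a $(3,1)$-lattice point mod $4$ lying in $S$ whose corresponding collection of intervals is MSTD if and only if it can be expressed as $$m = A\left(\frac{p}{D} + \frac{k}{D} + 4\ell\right)$$ where $k \in \mathbb{Z}^{2n}$ represents an element of the kernel of $A$ as an endomorphism of $(\mathbb{Z}/4D\mathbb{Z})^{2n}$, $\ell \in \mathbb{Z}^{2n}$, and $f = \frac{p}{D} + \frac{k}{D} + 4\ell$ satisfies $f \cdot \hat{e}_i \ge 0$ for all $i \in \{1,\dots,2n\}$ and $f \cdot \hat{e}_{i_j} > 0$ for some $j \in \{1, \dots, r\}$.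
   Context: A collection $J = \{[x_1,y_1], \dots, [x_n,y_n]\}$ of $n$ closed intervals with $x_1 \le y_1 \le x_2 \le y_2 \le \dots \le x_n \le y_n$ is represented by the point $\overline{J} = (x_1, y_1, \dots, x_n, y_n) \in \mathbb{R}^{2n}$; $J$ is identified with the union of its intervals. $J \pm J = \{a \pm b : a, b \in J\}$, $\mu$ is Lebesgue measure, and $J$ is MSTD if $\mu(J+J) > \mu(J-J)$. The comparison polynomials are the nonzero linear polynomials of the forms $x_i + x_j - x_k - x_\ell$, $x_i + x_j - y_k - y_\ell$, $y_i + y_j - y_k - y_\ell$, $x_i + y_\ell - x_j - y_k$ (indices in $\{1,\dots,n\}$); they record all comparisons between endpoints of the intervals $J_i + J_j$, and between endpoints of the intervals $J_i - J_j$, where $J_i = [x_i,y_i]$. The structure arrangement is the central hyperplane arrangement in $\mathbb{R}^{2n}$ given by the zero sets of all comparison polynomials. It partitions $\mathbb{R}^{2n}$ into closed polyhedral cones with disjoint nonempty interiors (the closures of the connected components of the complement of the arrangement); a structure cone for $\mathbb{I}_n$ is such a cone contained in $\{x_1 \le y_1 \le \dots \le x_n \le y_n\}$. On a structure cone $V$ there are vectors $v_+$ and $v_-$ (the sum vector and difference vector) with $\mu(J+J) = v_+ \cdot \overline{J}$ and $\mu(J-J) = v_- \cdot \overline{J}$ for all $\overline{J} \in V$; the MSTD vector of $V$ is $d = v_+ - v_-$. Thus for $\overline J \in V$, $J$ is MSTD if and only if $d \cdot \overline{J} > 0$. A simplicial cone in $\mathbb{R}^{2n}$ of full dimension is the set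 of all nonnegative linear combinations of $2n$ linearly independent vectors (its generators); it is rational if the generators can be chosen in $\mathbb{Z}^{2n}$, and a primitive integer vector is an integer vector with relatively prime entries. A partition of a polyhedral cone into simplicial cones is a finite family of such cones with pairwise disjoint interiors whose union is the cone. A point $x \in \mathbb{R}^{2n}$ is a $(3,1)$-lattice point mod $4$ if $x \in \mathbb{Z}^{2n}$ and $x \equiv (3,1,3,1,\dots,3,1) \pmod 4$. $\hat{e}_i$ denotes the $i$-th standard basis vector of $\mathbb{R}^{2n}$. *)

theory Defs
  imports "HOL-Analysis.Analysis" "HOL-Number_Theory.Cong"
begin

text \<open>
  The index set \<open>{1, ..., n}\<close> is a finite linearly ordered type \<open>'n\<close>, so that \<open>n = CARD('n) \<ge> 1\<close>.
  The \<open>2n\<close> coordinates are indexed by \<open>'n + 'n\<close>: coordinate \<open>Inl i\<close> is \<open>x\<^sub>i\<close> and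
  coordinate \<open>Inr i\<close> is \<open>y\<^sub>i\<close>.  The same type labels the \<open>2n\<close> generators of a simplicial cone,
  where the distinction between \<open>Inl\<close> and \<open>Inr\<close> has no meaning.
\<close>

type_synonym ('a, 'n) vec2 = "'a ^ ('n + 'n)"

abbreviation xc :: "('a, 'n::finite) vec2 \<Rightarrow> 'n \<Rightarrow> 'a"
  where "xc J i \<equiv> J $ Inl i"

abbreviation yc :: "('a, 'n::finite) vec2 \<Rightarrow> 'n \<Rightarrow> 'a"
  where "yc J i \<equiv> J $ Inr i"


subsection \<open>Collections of intervals\<close>

definition interval_collections :: "(real, 'n::{finite,linorder}) vec2 set"
  where "interval_collections =
    {J. (\<forall>i. xc J i \<le> yc J i) \<and> (\<forall>i j. i < j \<longrightarrow> yc J i \<le> xc J j)}"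

definition interval_union :: "(real, 'n::finite) vec2 \<Rightarrow> real set"
  where "interval_union J = (\<Union>i. {xc J i .. yc J i})"

text \<open>The operator \<open>-\<close> on sets is set difference, hence the explicit definitions.\<close>

definition sumset :: "real set \<Rightarrow> real set"
  where "sumset X = {a + b | a b. a \<in> X \<and> b \<in> X}"

definition diffset :: "real set \<Rightarrow> real set"
  where "diffset X = {a - b | a b. a \<in> X \<and> b \<in> X}"

definition MSTD :: "real set \<Rightarrow> bool"
  where "MSTD X \<longleftrightarrow> measure lebesgue (sumset X) > measure lebesgue (diffset X)"


subsection \<open>The structure arrangement and its cones\<close>

definition comparison_polynomials :: "((real, 'n::finite) vec2 \<Rightarrow> real) set"
  where "comparison_polynomials =
    ({\<lambda>J. xc J i + xc J j - xc J k - xc J l | i j k l. True} \<union>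
     {\<lambda>J. xc J i + xc J j - yc J k - yc J l | i j k l. True} \<union>
     {\<lambda>J. yc J i + yc J j - yc J k - yc J l | i j k l. True} \<union>
     {\<lambda>J. xc J i + yc J l - xc J j - yc J k | i j k l. True}) - {\<lambda>J. 0}"

definition structure_arrangement :: "(real, 'n::finite) vec2 set set"
  where "structure_arrangement = (\<lambda>f. {J. f J = 0}) ` comparison_polynomials"

definition structure_cone :: "(real, 'n::{finite,linorder}) vec2 set \<Rightarrow> bool"
  where "structure_cone V \<longleftrightarrow>
    V \<in> closure ` components (- \<Union>structure_arrangement) \<and> V \<subseteq> interval_collections"

text \<open>A structure cone has nonempty interior, so each of the following vectors is unique.\<close>

definition sum_vector :: "(real, 'n::finite) vec2 set \<Rightarrow> (real, 'n) vec2 \<Rightarrow> bool"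
  where "sum_vector V u \<longleftrightarrow>
    (\<forall>J\<in>V. measure lebesgue (sumset (interval_union J)) = u \<bullet> J)"

definition difference_vector :: "(real, 'n::finite) vec2 set \<Rightarrow> (real, 'n) vec2 \<Rightarrow> bool"
  where "difference_vector V u \<longleftrightarrow>
    (\<forall>J\<in>V. measure lebesgue (diffset (interval_union J)) = u \<bullet> J)"

definition MSTD_vector :: "(real, 'n::finite) vec2 set \<Rightarrow> (real, 'n) vec2 \<Rightarrow> bool"
  where "MSTD_vector V d \<longleftrightarrow>
    (\<exists>u w. sum_vector V u \<and> difference_vector V w \<and> d = u - w)"


subsection \<open>Integer vectors and simplicial cones\<close>

definition real_vec :: "int ^ 'm \<Rightarrow> real ^ 'm"
  where "real_vec z = (\<chi> i. real_of_int (z $ i))"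

definition real_mat :: "int ^ 'm ^ 'k \<Rightarrow> real ^ 'm ^ 'k"
  where "real_mat A = (\<chi> i j. real_of_int (A $ i $ j))"

definition vec_cong :: "int ^ 'm \<Rightarrow> int ^ 'm \<Rightarrow> int \<Rightarrow> bool"
  where "vec_cong u w q \<longleftrightarrow> (\<forall>i. [u $ i = w $ i] (mod q))"

definition primitive_vec :: "int ^ 'm \<Rightarrow> bool"
  where "primitive_vec z \<longleftrightarrow> Gcd (range (\<lambda>i. z $ i)) = 1"

text \<open>The index type of the family is that of the coordinates, so the cone has full dimension.\<close>

definition simplicial_generators :: "(real ^ 'm) set \<Rightarrow> ('m \<Rightarrow> real ^ 'm) \<Rightarrow> bool"
  where "simplicial_generators S g \<longleftrightarrow>
    inj g \<and> independent (range g) \<and>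
    S = {\<Sum>i\<in>UNIV. c i *\<^sub>R g i | c. \<forall>i. c i \<ge> 0}"

definition simplicial_cone :: "(real ^ 'm) set \<Rightarrow> bool"
  where "simplicial_cone S \<longleftrightarrow> (\<exists>g. simplicial_generators S g)"

definition rational_simplicial_cone :: "(real ^ 'm) set \<Rightarrow> bool"
  where "rational_simplicial_cone S \<longleftrightarrow>
    (\<exists>g. simplicial_generators S (\<lambda>i. real_vec (g i)))"

definition simplicial_partition :: "(real ^ 'm) set set \<Rightarrow> (real ^ 'm) set \<Rightarrow> bool"
  where "simplicial_partition P C \<longleftrightarrow>
    finite P \<and> (\<forall>S\<in>P. simplicial_cone S) \<and>
    pairwise (\<lambda>S T. interior S \<inter> interior T = {}) P \<and> \<Union>P = C"


subsection \<open>Lattice points\<close>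

definition vec31 :: "(int, 'n::finite) vec2"
  where "vec31 = (\<chi> s. case s of Inl i \<Rightarrow> 3 | Inr i \<Rightarrow> 1)"

definition lattice_point31 :: "(real, 'n::finite) vec2 \<Rightarrow> bool"
  where "lattice_point31 m \<longleftrightarrow> (\<exists>z. m = real_vec z \<and> vec_cong z vec31 4)"

end

theory Submission
  imports Defs
begin

text \<open>
  Write \<open>m = A f\<close>.  Membership in \<open>S\<close> means \<open>f \<ge> 0\<close>, and since
  \<open>d \<bullet> m\<close> is the sum of the nonnegative terms \<open>f\<^sub>i (v\<^sub>i \<bullet> d)\<close>, it is positive
  iff one of them is.  If \<open>m\<close> is integral, then so is \<open>q = D f\<close> by Cramer's rule;
  \<open>m\<close> is a \<open>(3,1)\<close>-lattice point iff \<open>A q \<equiv> A p (mod 4D)\<close>, which makes \<open>k = q - p\<close>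
  an element of the kernel, so that even \<open>l = 0\<close> suffices.
\<close>

lemma real_vec_component [simp]: "real_vec z $ i = real_of_int (z $ i)"
  by (simp add: real_vec_def)

lemma real_mat_component [simp]: "real_mat A $ i $ j = real_of_int (A $ i $ j)"
  by (simp add: real_mat_def)

lemma real_vec_eq_iff [simp]: "real_vec y = real_vec z \<longleftrightarrow> y = z"
  by (simp add: vec_eq_iff)

lemma real_vec_scale: "real_vec (c *s z) = real_of_int c *\<^sub>R real_vec z"
  by (simp add: vec_eq_iff)

lemma real_mat_mult_real_vec:
  fixes A :: "int ^ 'm::finite ^ 'k"
  shows "real_mat A *v real_vec z = real_vec (A *v z)"
  by (simp add: vec_eq_iff matrix_vector_mult_def)

lemma det_real_mat: "det (real_mat A) = real_of_int (det A)"
  by (simp add: det_def)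

lemma real_mat_mult_eq_sum:
  fixes A :: "int ^ 'm::finite ^ 'k"
  shows "real_mat A *v f = (\<Sum>i\<in>UNIV. (f $ i) *\<^sub>R real_vec (column i A))"
  by (simp add: vec_eq_iff matrix_vector_mult_def column_def mult.commute)

text \<open>Turns congruences into exact vector equations, to which \<open>A\<close> can be applied
  and which can be divided by \<open>D\<close>.\<close>

lemma vec_cong_iff:
  "vec_cong u w q \<longleftrightarrow> (\<exists>t. u = w + q *s t)"
proof
  assume "vec_cong u w q"
  then have "\<forall>i. \<exists>c. u $ i = w $ i + q * c"
    unfolding vec_cong_def by (metis cong_iff_lin cong_sym)
  then obtain c where "\<And>i. u $ i = w $ i + q * c i"
    by metis
  then have "u = w + q *s (\<chi> i. c i)"
    by (simp add: vec_eq_iff)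
  then show "\<exists>t. u = w + q *s t" ..
qed (auto simp: vec_cong_def cong_def)

text \<open>By Cramer's rule, \<open>f $ k * det A\<close> is the determinant of \<open>A\<close>
  with column \<open>k\<close> replaced by \<open>z\<close>, and all entries of that matrix are
  integers.\<close>

lemma abs_det_scale_integral:
  fixes A :: "int ^ 'm ^ 'm::finite"
  assumes "real_mat A *v f = real_vec z"
  obtains q where "real_of_int \<bar>det A\<bar> *\<^sub>R f = real_vec q"
proof
  let ?B = "\<lambda>k. \<chi> i j. if j = k then z $ i else A $ i $ j"
  have "real_of_int (det (?B k)) = f $ k * real_of_int (det A)" for k
  proof -
    have "real_mat (?B k) =
      (\<chi> i j. if j = k then (real_mat A *v f) $ i else real_mat A $ i $ j)"
      by (simp add: assms vec_eq_iff)
    then show ?thesis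
      using cramer_lemma[of k "real_mat A" f] by (simp flip: det_real_mat)
  qed
  \<comment> \<open>The factor \<open>sgn (det A)\<close> accounts for the absolute value in
    \<open>D\<close>.\<close>
  then show "real_of_int \<bar>det A\<bar> *\<^sub>R f = real_vec (\<chi> k. sgn (det A) * det (?B k))"
    by (simp add: vec_eq_iff abs_sgn)
qed

lemma simplicial_generators_mem_iff:
  fixes A :: "int ^ 'm ^ 'm::finite"
  assumes "simplicial_generators S (\<lambda>i. real_vec (column i A))"
  shows "x \<in> S \<longleftrightarrow> (\<exists>f. x = real_mat A *v f \<and> (\<forall>i. f $ i \<ge> 0))" (is "_ \<longleftrightarrow> ?R")
proof
  assume "x \<in> S"
  then obtain c where "x = (\<Sum>i\<in>UNIV. c i *\<^sub>R real_vec (column i A))" "\<forall>i. c i \<ge> 0"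
    using assms by (auto simp: simplicial_generators_def)
  then show ?R
    by (intro exI[of _ "\<chi> i. c i"]) (simp add: real_mat_mult_eq_sum)
next
  assume ?R
  then show "x \<in> S"
    using assms by (auto simp: simplicial_generators_def real_mat_mult_eq_sum)
qed

lemma simplicial_generators_det_nonzero:
  fixes A :: "int ^ 'm ^ 'm::finite"
  assumes "simplicial_generators S (\<lambda>i. real_vec (column i A))"
  shows "det A \<noteq> 0"
proof -
  let ?g = "\<lambda>i. real_vec (column i A)"
  have inj: "inj ?g" and ind: "independent (range ?g)"
    using assms by (auto simp: simplicial_generators_def)
  have "c i = 0" if c: "(\<Sum>i\<in>UNIV. c i *s column i (real_mat A)) = 0" for c i
  proof -
    have col: "column i (real_mat A) = ?g i" for i
      by (simp add: vec_eq_iff column_def)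
    \<comment> \<open>Independence of a set takes coefficients indexed by its vectors, so
      \<open>c\<close> is transported along the inverse of \<open>?g\<close>; injectivity ensures
      that no two columns merge.\<close>
    have "(\<Sum>w\<in>range ?g. c (inv ?g w) *\<^sub>R w) = (\<Sum>i\<in>UNIV. c i *\<^sub>R ?g i)"
      by (simp add: sum.reindex[OF inj] inv_f_f[OF inj])
    also have "\<dots> = 0"
      using c by (simp add: col scalar_mult_eq_scaleR)
    finally have "c (inv ?g (?g i)) = 0"
      using independentD[OF ind, of "range ?g" "\<lambda>w. c (inv ?g w)" "?g i"] by simp
    then show ?thesis
      by (simp add: inv_f_f[OF inj])
  qed
  then have "invertible (real_mat A)"
    unfolding invertible_left_inverse matrix_left_invertible_independent_columns by blast
  then show ?thesis
    by (simp add: invertible_det_nz det_real_mat)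
qed

lemma MSTD_iff_MSTD_vector_pos:
  assumes "MSTD_vector V d" "J \<in> V"
  shows "MSTD (interval_union J) \<longleftrightarrow> d \<bullet> J > 0"
  using assms
  by (auto simp: MSTD_vector_def sum_vector_def difference_vector_def MSTD_def inner_diff_left)

text \<open>The purely arithmetic half: \<open>f\<close> is an arbitrary real vector here, with no
  cone or sign condition.\<close>

lemma lattice_point_iff:
  fixes A :: "int ^ ('n + 'n) ^ ('n + 'n::finite)"
  assumes D: "D = \<bar>det A\<bar>" "D \<noteq> 0" and p: "vec_cong (A *v p) (D *s vec31) (4 * D)"
  shows "lattice_point31 (real_mat A *v f) \<longleftrightarrow>
    (\<exists>k l. vec_cong (A *v k) 0 (4 * D) \<and>
       f = (1 / real_of_int D) *\<^sub>R real_vec p + (1 / real_of_int D) *\<^sub>R real_vec k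
             + 4 *\<^sub>R real_vec l)"
    (is "_ \<longleftrightarrow> ?R")
proof -
  obtain t where t: "A *v p = D *s vec31 + (4 * D) *s t"
    using p by (auto simp: vec_cong_iff)
  show ?thesis
  proof
    assume "lattice_point31 (real_mat A *v f)"
    then obtain s where s: "real_mat A *v f = real_vec (vec31 + 4 *s s)"
      by (auto simp: lattice_point31_def vec_cong_iff)
    then obtain q where q: "real_of_int D *\<^sub>R f = real_vec q"
      using abs_det_scale_integral D(1) by metis
    \<comment> \<open>Both sides are \<open>D\<close> times \<open>A f\<close>: the left one through
      \<open>q = D f\<close>, the right one through \<open>s\<close>.\<close>
    have "real_vec (A *v q) = real_vec (D *s (vec31 + 4 *s s))"
      unfolding real_vec_scale
      by (simp flip: q real_mat_mult_real_vec add: s matrix_vector_mult_scaleR)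
    then have "A *v q = D *s (vec31 + 4 *s s)"
      by (simp only: real_vec_eq_iff)
    \<comment> \<open>Subtracting \<open>t\<close> cancels \<open>D *s vec31\<close>, and a multiple
      of \<open>4 * D\<close> remains.\<close>
    then have "A *v (q - p) = (4 * D) *s (s - t)"
      by (simp add: matrix_vector_mult_diff_distrib t vec_eq_iff algebra_simps)
    then have "vec_cong (A *v (q - p)) 0 (4 * D)"
      unfolding vec_cong_iff by (metis add_0)
    \<comment> \<open>Since \<open>k\<close> is an integer vector and not a reduced residue, it
      absorbs all multiples of \<open>4 * D\<close>, which leaves \<open>l = 0\<close>.\<close>
    moreover have "f = (1 / real_of_int D) *\<^sub>R real_vec p
        + (1 / real_of_int D) *\<^sub>R real_vec (q - p) + 4 *\<^sub>R real_vec 0"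
      using q D(2) by (simp add: vec_eq_iff field_simps)
    ultimately show ?R by blast
  next
    assume ?R
    then obtain k l u where k: "A *v k = (4 * D) *s u"
      and f: "f = (1 / real_of_int D) *\<^sub>R real_vec p + (1 / real_of_int D) *\<^sub>R real_vec k
             + 4 *\<^sub>R real_vec l"
      by (auto simp: vec_cong_iff)
    \<comment> \<open>After multiplication by \<open>D\<close>, the terms in \<open>p\<close>,
      \<open>k\<close> and \<open>l\<close> contribute \<open>D *s vec31 + (4 * D) *s t\<close>,
      \<open>(4 * D) *s u\<close> and \<open>(4 * D) *s (A *v l)\<close>; the common factor
      \<open>D\<close> is nonzero.\<close>
    have "real_mat A *v f = real_vec (vec31 + 4 *s (t + u + A *v l))"
      using D(2)
      by (simp add: f matrix_vector_right_distrib matrix_vector_mult_scaleR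
          real_mat_mult_real_vec t k vec_eq_iff field_simps)
    then show "lattice_point31 (real_mat A *v f)"
      unfolding lattice_point31_def vec_cong_iff by blast
  qed
qed

theorem mainTheorem4:
  fixes V S :: "(real, 'n::{finite,linorder}) vec2 set"
    and P :: "(real, 'n) vec2 set set"
    and d m :: "(real, 'n) vec2"
    and v :: "'n + 'n \<Rightarrow> (int, 'n) vec2"
    and A :: "int ^ ('n + 'n) ^ ('n + 'n)"
    and D :: int
    and p :: "(int, 'n) vec2"
  assumes "structure_cone V"
    and "MSTD_vector V d"
    and "\<exists>u\<in>V. d \<bullet> u > 0"
    and "simplicial_partition P (V \<inter> {u. d \<bullet> u \<ge> 0})"
    and "S \<in> P"
    and "rational_simplicial_cone S"
    and "simplicial_generators S (\<lambda>i. real_vec (v i))"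
    and "\<And>i. primitive_vec (v i)"
    and "\<And>i. column i A = v i"
    and "D = \<bar>det A\<bar>"
    and "vec_cong (A *v p) (D *s vec31) (4 * D)"
  shows "lattice_point31 m \<and> m \<in> S \<and> MSTD (interval_union m) \<longleftrightarrow>
    (\<exists>(k :: (int, 'n) vec2) (l :: (int, 'n) vec2) (f :: (real, 'n) vec2).
       vec_cong (A *v k) 0 (4 * D) \<and>
       f = (1 / real_of_int D) *\<^sub>R real_vec p + (1 / real_of_int D) *\<^sub>R real_vec k
             + 4 *\<^sub>R real_vec l \<and>
       m = real_mat A *v f \<and>
       (\<forall>i. f \<bullet> axis i 1 \<ge> 0) \<and>
       (\<exists>j. real_vec (v j) \<bullet> d > 0 \<and> f \<bullet> axis j 1 > 0))"
proof -
  have gen: "simplicial_generators S (\<lambda>i. real_vec (column i A))"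
    using assms(7,9) by simp
  have D: "D \<noteq> 0"
    using simplicial_generators_det_nonzero[OF gen] assms(10) by simp
  have S: "S \<subseteq> V" "\<And>u. u \<in> S \<Longrightarrow> d \<bullet> u \<ge> 0"
    using assms(4,5) by (auto simp: simplicial_partition_def)
  have MSTD: "MSTD (interval_union (real_mat A *v f)) \<longleftrightarrow>
      (\<exists>j. real_vec (v j) \<bullet> d > 0 \<and> f $ j > 0)"
    if f: "\<forall>i. f $ i \<ge> 0" for f
  proof -
    \<comment> \<open>Each generator is the image of a unit vector, so it lies in \<open>S\<close>
      and hence in the half-space of \<open>d\<close>. This makes every term of the sum below
      nonnegative.\<close>
    have v: "real_vec (v i) \<bullet> d \<ge> 0" for i
    proof -
      have "real_vec (v i) = real_mat A *v axis i 1"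
        by (simp add: real_mat_mult_eq_sum assms(9) axis_def if_distrib if_distribR cong: if_cong)
      then have "real_vec (v i) \<in> S"
        using simplicial_generators_mem_iff[OF gen] by (force simp: axis_def)
      then show ?thesis
        using S(2) inner_commute by metis
    qed
    have "real_mat A *v f \<in> V"
      using S(1) f simplicial_generators_mem_iff[OF gen] by blast
    then have "MSTD (interval_union (real_mat A *v f)) \<longleftrightarrow> d \<bullet> (real_mat A *v f) > 0"
      by (rule MSTD_iff_MSTD_vector_pos[OF assms(2)])
    also have "d \<bullet> (real_mat A *v f) = (\<Sum>i\<in>UNIV. f $ i * (real_vec (v i) \<bullet> d))"
      by (simp add: real_mat_mult_eq_sum assms(9) inner_sum_right inner_commute)
    also have "\<dots> > 0 \<longleftrightarrow> (\<exists>j. f $ j * (real_vec (v j) \<bullet> d) > 0)"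
      using f v
      by (smt (verit) finite_class.finite_UNIV iso_tuple_UNIV_I mult_nonneg_nonneg
          sum_pos2 sum_nonpos)
    also have "\<dots> \<longleftrightarrow> (\<exists>j. real_vec (v j) \<bullet> d > 0 \<and> f $ j > 0)"
      using f v by (metis mult_pos_pos mult_zero_left mult_zero_right order_less_le)
    finally show ?thesis .
  qed
  \<comment> \<open>The fact \<open>MSTD\<close> holds only for nonnegative coefficients, so
    \<open>m \<in> S\<close> has to supply \<open>f\<close> first.\<close>
  have "lattice_point31 m \<and> m \<in> S \<and> MSTD (interval_union m) \<longleftrightarrow>
    (\<exists>f. m = real_mat A *v f \<and> (\<forall>i. f $ i \<ge> 0) \<and> lattice_point31 (real_mat A *v f) \<and>
      (\<exists>j. real_vec (v j) \<bullet> d > 0 \<and> f $ j > 0))"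
    using simplicial_generators_mem_iff[OF gen, of m] MSTD by metis
  then show ?thesis
    unfolding lattice_point_iff[OF assms(10) D assms(11)] inner_axis inner_real_def mult_1_right
    by blast
qed

end
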